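(* Let the $2n\times2n$ matrix $\tilde{\mathbf d}$ correspond to a variance bound and define $\tilde u=y-\mathbf X\tilde b^{opt}$ and $u=y-\mathbf X b^{opt}$, where $\tilde b^{opt}=(\mathbf X'\tilde{\mathbf d}\mathbf X)^{(-)}\mathbf X'\tilde{\mathbf d}y$ and $b^{opt}=(\mathbf X'\mathbf d\mathbf X)^{(-)}\mathbf X'\mathbf d y$. Then for all $y\in\mathbb R^{2n}$, $$n^{-2}u'\mathbf d u\le n^{-2}\tilde u'\tilde{\mathbf d}\tilde u\le n^{-2}u'\tilde{\mathbf d}u.$$ Hence $n^{-2}\tilde u'\tilde{\mathbf d}\tilde u$ is a tighter bound for the variance of the fixed-coefficient generalized regression estimator with optimal coefficient $b^{opt}$ than $n^{-2}u'\tilde{\mathbf d}u$.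
   Context: For $n$ units, $R_{1i}\in\{0,1\}$ is the random treatment indicator of unit $i$ (arbitrary joint distribution with $0<\mathrm E[R_{1i}]<1$), $R_{0i}=1-R_{1i}$, $\mathbf R=\mathrm{diag}(R_{01},\dots,R_{0n},R_{11},\dots,R_{1n})$, $\boldsymbol\pi=\mathrm E[\mathbf R]$. $\mathbf d=\mathrm V(1_{2n}'\boldsymbol\pi^{-1}\mathbf R)$ is the $2n\times2n$ variance-covariance matrix of the vector $1_{2n}'\boldsymbol\pi^{-1}\mathbf R$, where $1_{2n}$ is the vector of $2n$ ones. $\mathbf X$ is a fixed real $2n\times l$ covariate matrix. $y=(-y_{01},\dots,-y_{0n},y_{11},\dots,y_{1n})'$ is the vector of (fixed) potential outcomes, $y_{0i}$ and $y_{1i}$ being the outcomes of unit $i$ under control and treatment. $(\cdot)^{(-)}$ is the Moore–Penrose inverse. An arbitrary $2n\times 2n$ matrix $\tilde{\mathbf d}$ corresponds to a variance bound if $n^{-2}v'\mathbf d v\le n^{-2}v'\tilde{\mathbf d}v$ for all $v\in\mathbb R^{2n}$. The fixed-coefficient generalized regression estimator with constant coefficient $b$ is $n^{-1}1_{2n}'\boldsymbol\pi^{-1}\mathbf R y-n^{-1}1_{2n}'(\boldsymbol\pi^{-1}\mathbf R-\mathbf i_{2n})\mathbf X b$ ($\mathbf i_{2n}$ the identity); its variance is $n^{-2}(y-\mathbf Xb)'\mathbf d(y-\mathbf Xb)$. One bound is called tighter than another if it is no larger for all $y\in\mathbb R^{2n}$.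
   Formalization: The second inequality and the tightness claim are stated only for symmetric d̃, since they fail for some non-symmetric d̃ (e.g. n=l=1, E[R]=1/2, d̃=[[1,0],[-2,1]], X=(1,0)', y=(0,1)'); the first inequality and both bound claims hold for arbitrary d̃. *)

theory Defs
  imports "HOL-Probability.Probability"
begin

text \<open>
  Units are the elements of a finite type \<open>'n\<close>, so \<open>n = CARD('n)\<close>.  The \<open>2n\<close> coordinates are
  indexed by \<open>'n + 'n\<close>: \<open>Inl i\<close> is unit \<open>i\<close> under control, \<open>Inr i\<close> is unit \<open>i\<close> under treatment.
  A vector \<open>y :: real ^ ('n + 'n)\<close> carries the sign convention
  \<open>y = (-y\<^sub>0\<^sub>1, \<dots>, -y\<^sub>0\<^sub>n, y\<^sub>1\<^sub>1, \<dots>, y\<^sub>1\<^sub>n)'\<close>, i.e. \<open>y $ Inl i\<close> is minus the control outcome.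
\<close>

definition is_Moore_Penrose :: "real ^ 'a ^ 'b \<Rightarrow> real ^ 'b ^ 'a \<Rightarrow> bool" where
  "is_Moore_Penrose A G \<longleftrightarrow>
     A ** G ** A = A \<and> G ** A ** G = G \<and>
     transpose (A ** G) = A ** G \<and> transpose (G ** A) = G ** A"

text \<open>Every real matrix has exactly one inverse in this sense; uniqueness is the next lemma.\<close>

definition Moore_Penrose_inv :: "real ^ 'a ^ 'b \<Rightarrow> real ^ 'b ^ 'a" where
  "Moore_Penrose_inv A = (THE G. is_Moore_Penrose A G)"

lemma is_Moore_Penrose_unique:
  assumes G: "is_Moore_Penrose A G" and H: "is_Moore_Penrose A H"
  shows "G = H"
proof -
  note g = G[unfolded is_Moore_Penrose_def] and h = H[unfolded is_Moore_Penrose_def]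
  have "A ** G = transpose (A ** H ** (A ** G))"
    using g h by (metis matrix_mul_assoc)
  also have "\<dots> = A ** G ** (A ** H)"
    using g h by (simp add: matrix_transpose_mul)
  also have "\<dots> = A ** H"
    using g by (metis matrix_mul_assoc)
  finally have AG: "A ** G = A ** H" .
  have "G ** A = transpose (G ** A ** (H ** A))"
    using g h by (metis matrix_mul_assoc)
  also have "\<dots> = H ** A ** (G ** A)"
    using g h by (simp add: matrix_transpose_mul)
  also have "\<dots> = H ** A"
    using g by (metis matrix_mul_assoc)
  finally have GA: "G ** A = H ** A" .
  show ?thesis
    using g h AG GA by (metis matrix_mul_assoc)
qed

lemma Moore_Penrose_inv_eq: "is_Moore_Penrose A G \<Longrightarrow> Moore_Penrose_inv A = G"
  unfolding Moore_Penrose_inv_def by (blast intro: is_Moore_Penrose_unique)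

definition treatment_matrix ::
    "('n::finite \<Rightarrow> 'w \<Rightarrow> real) \<Rightarrow> 'w \<Rightarrow> real ^ ('n + 'n) ^ ('n + 'n)" where
  "treatment_matrix R1 w =
     (\<chi> a b. if a = b then (case a of Inl i \<Rightarrow> 1 - R1 i w | Inr i \<Rightarrow> R1 i w) else 0)"

definition expected_matrix ::
    "'w measure \<Rightarrow> ('w \<Rightarrow> real ^ 'a ^ 'b) \<Rightarrow> real ^ 'a ^ 'b" where
  "expected_matrix M A = (\<chi> i j. integral\<^sup>L M (\<lambda>w. A w $ i $ j))"

definition covariance_matrix :: "'w measure \<Rightarrow> ('w \<Rightarrow> real ^ 'a) \<Rightarrow> real ^ 'a ^ 'a" where
  "covariance_matrix M Z =
     (\<chi> i j. integral\<^sup>L M (\<lambda>w. (Z w $ i - integral\<^sup>L M (\<lambda>v. Z v $ i)) *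
                              (Z w $ j - integral\<^sup>L M (\<lambda>v. Z v $ j))))"

definition inv_pi :: "'w measure \<Rightarrow> ('n::finite \<Rightarrow> 'w \<Rightarrow> real) \<Rightarrow> real ^ ('n + 'n) ^ ('n + 'n)" where
  "inv_pi M R1 = matrix_inv (expected_matrix M (treatment_matrix R1))"

definition design_matrix ::
    "'w measure \<Rightarrow> ('n::finite \<Rightarrow> 'w \<Rightarrow> real) \<Rightarrow> real ^ ('n + 'n) ^ ('n + 'n)" where
  "design_matrix M R1 =
     covariance_matrix M (\<lambda>w. 1 v* (inv_pi M R1 ** treatment_matrix R1 w))"

text \<open>The scaled quadratic form \<open>n\<^sup>-\<^sup>2 v' A v\<close>, where \<open>n\<close> is half the dimension of \<open>v\<close>.\<close>

definition scaled_qform :: "real ^ ('n + 'n) ^ ('n::finite + 'n) \<Rightarrow> real ^ ('n + 'n) \<Rightarrow> real" where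
  "scaled_qform A v = (v \<bullet> (A *v v)) / (real CARD('n))\<^sup>2"

text \<open>
  As in the informal definition, \<open>dt\<close> is arbitrary here.  Symmetry matters later: only for symmetric
  \<open>dt\<close> does \<open>opt_coeff X dt y\<close> below minimise \<open>scaled_qform dt (y - X *v b)\<close> over \<open>b\<close> in general.
\<close>

definition corresponds_to_variance_bound ::
    "real ^ ('n + 'n) ^ ('n::finite + 'n) \<Rightarrow> real ^ ('n + 'n) ^ ('n + 'n) \<Rightarrow> bool" where
  "corresponds_to_variance_bound d dt \<longleftrightarrow> (\<forall>v. scaled_qform d v \<le> scaled_qform dt v)"

definition opt_coeff ::
    "real ^ 'l ^ 'm \<Rightarrow> real ^ 'm ^ 'm \<Rightarrow> real ^ 'm \<Rightarrow> real ^ 'l" where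
  "opt_coeff X A y = (Moore_Penrose_inv (transpose X ** A ** X) ** transpose X ** A) *v y"

definition greg_estimator ::
    "'w measure \<Rightarrow> ('n::finite \<Rightarrow> 'w \<Rightarrow> real) \<Rightarrow> real ^ 'l ^ ('n + 'n) \<Rightarrow> real ^ ('n + 'n) \<Rightarrow>
     real ^ 'l \<Rightarrow> 'w \<Rightarrow> real" where
  "greg_estimator M R1 X y b w =
     ((1 v* (inv_pi M R1 ** treatment_matrix R1 w)) \<bullet> y) / real CARD('n)
     - ((1 v* (inv_pi M R1 ** treatment_matrix R1 w - mat 1)) \<bullet> (X *v b)) / real CARD('n)"

text \<open>
  Bounds for a variance that depends on the outcome vector are functions of that vector and are
  compared pointwise.
\<close>

definition is_bound_for :: "('y \<Rightarrow> real) \<Rightarrow> ('y \<Rightarrow> real) \<Rightarrow> bool" where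
  "is_bound_for B V \<longleftrightarrow> (\<forall>y. V y \<le> B y)"

definition tighter_than :: "('y \<Rightarrow> real) \<Rightarrow> ('y \<Rightarrow> real) \<Rightarrow> bool" where
  "tighter_than B B' \<longleftrightarrow> (\<forall>y. B y \<le> B' y)"

end

(* For a symmetric positive semidefinite D the normal equations X'DX b = X'Dy are solvable, and
   opt_coeff X D y solves them; hence it minimises (y - Xb)'D(y - Xb) over b.  For D = d, a covariance
   matrix, this gives u'd u <= ut'd ut <= ut'dt ut, whether or not dt is symmetric.  If it is, then
   dt, being above d, is positive semidefinite, and D = dt gives ut'dt ut <= u'dt u. *)

theory Submission
  imports Defs
begin

section \<open>Moore-Penrose inverses of symmetric matrices\<close>

lemma inner_symmetric_matrix:
  fixes A :: "real ^ 'a ^ 'a"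
  assumes "transpose A = A"
  shows "x \<bullet> (A *v y) = (A *v x) \<bullet> y"
  using assms by (simp add: dot_lmul_matrix flip: matrix_transpose_mul vector_transpose_matrix)

text \<open>For an orthonormal basis \<open>B\<close> of \<open>S\<close>, the map sending
  \<open>x\<close> to the sum of \<open>(x \<bullet> b) *\<^sub>R b\<close> over \<open>B\<close> is
  linear and self-adjoint, has values in \<open>S\<close> and fixes \<open>B\<close>, hence all of
  \<open>S\<close>. Its matrix is the required \<open>P\<close>.\<close>

lemma orthogonal_projection_matrix_exists:
  fixes S :: "(real ^ 'a) set"
  assumes "subspace S"
  obtains P :: "real ^ 'a ^ 'a" where "transpose P = P" "\<And>x. P *v x \<in> S" "\<And>x. x \<in> S \<Longrightarrow> P *v x = x"
proof -
  obtain B where B: "B \<subseteq> S" "pairwise orthogonal B" "\<And>x. x \<in> B \<Longrightarrow> norm x = 1"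
      "independent B" "span B = S"
    using orthonormal_basis_subspace[OF assms] by metis
  have fin: "finite B"
    using B(4) independent_bound by blast
  define p where "p x = (\<Sum>b\<in>B. (x \<bullet> b) *\<^sub>R b)" for x
  have lin: "linear p"
    unfolding p_def
    by (rule linearI) (simp_all add: inner_add_left scaleR_add_left sum.distrib scaleR_sum_right)
  have adj: "x \<bullet> p y = p x \<bullet> y" for x y
    unfolding p_def by (simp add: inner_sum_left inner_sum_right inner_commute mult.commute)
  have inS: "p x \<in> S" for x
    unfolding p_def using B(1) assms by (auto intro!: subspace_sum subspace_scale)
  have fixB: "p b = b" if "b \<in> B" for b
  proof -
    have "p b = (\<Sum>c\<in>B. if c = b then b else 0)"
      unfolding p_def
    proof (rule sum.cong)
      fix c assume c: "c \<in> B"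
      show "(b \<bullet> c) *\<^sub>R c = (if c = b then b else 0)"
        using B(2,3) c that by (auto simp: pairwise_def orthogonal_def norm_eq_1)
    qed simp
    then show ?thesis
      using fin that by simp
  qed
  have fixS: "p x = x" if "x \<in> S" for x
    using linear_eq_on_span[OF lin linear_id, of B] fixB that B(5) by simp
  have P: "matrix p *v x = p x" for x
    using matrix_vector_mul(2)[OF lin] by (rule fun_cong)
  have "transpose (matrix p) *v x = matrix p *v x" for x
    by (rule vector_eq_ldot[THEN iffD1])
      (metis P adj dot_lmul_matrix vector_transpose_matrix transpose_transpose inner_commute)
  then have "transpose (matrix p) = matrix p"
    by (simp add: matrix_eq)
  with P inS fixS that show ?thesis
    by metis
qed

(* With P the orthogonal projection onto the range of A, the matrix B = A + 1 - P is invertible,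
   commutes with P and agrees with A on the range of A; the inverse is then B^-1 P. *)
lemma is_Moore_Penrose_exists_symmetric:
  fixes A :: "real ^ 'a ^ 'a"
  assumes sym: "transpose A = A"
  shows "\<exists>G. is_Moore_Penrose A G"
proof -
  have "subspace (range ((*v) A))"
    by (simp add: linear_subspace_image)
  then obtain P where P: "transpose P = P" "\<And>x. P *v x \<in> range ((*v) A)"
      "\<And>x. x \<in> range ((*v) A) \<Longrightarrow> P *v x = x"
    using orthogonal_projection_matrix_exists by metis
  have PA: "P ** A = A"
    by (auto simp: matrix_eq P(3) simp flip: matrix_vector_mul_assoc)
  have AP: "A ** P = A"
    by (metis PA P(1) sym matrix_transpose_mul)
  have PP: "P ** P = P"
    by (auto simp: matrix_eq P(2,3) simp flip: matrix_vector_mul_assoc)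
  define B where "B = A + mat 1 - P"
  have B: "B *v x = A *v x + x - P *v x" for x
    by (simp add: B_def matrix_vector_mult_diff_rdistrib matrix_vector_mult_add_rdistrib)
  have BP: "B ** P = A"
    by (simp add: matrix_eq B flip: matrix_vector_mul_assoc)
      (simp add: matrix_vector_mul_assoc AP PP)
  have PB: "P ** B = A"
    by (simp add: matrix_eq B matrix_vector_right_distrib matrix_vector_mult_diff_distrib
        flip: matrix_vector_mul_assoc)
      (simp add: matrix_vector_mul_assoc PA PP)
  \<comment> \<open>Injectivity of \<open>B\<close>: applying \<open>P\<close> to
    \<open>B *v x = 0\<close> gives \<open>A *v x = 0\<close>, so what remains of the equation is
    \<open>x = P *v x\<close>, which lies in the range of \<open>A\<close>. For symmetric
    \<open>A\<close> the range is orthogonal to the kernel, so \<open>x\<close> is orthogonal to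
    itself.\<close>
  have "x = 0" if "B *v x = 0" for x
  proof -
    have Ax: "A *v x = 0"
      using that PB by (metis matrix_vector_mul_assoc matrix_vector_mult_0_right)
    have "A *v x + x - P *v x = 0"
      using that by (simp add: B)
    then obtain z where "x = A *v z"
      using Ax P(2)[of x] by auto
    then have "x \<bullet> x = 0"
      using inner_symmetric_matrix[OF sym, of x z] Ax by simp
    then show ?thesis by simp
  qed
  then obtain C where CB: "C ** B = mat 1"
    using matrix_left_invertible_ker by blast
  then have BC: "B ** C = mat 1"
    using matrix_left_right_inverse by blast
  \<comment> \<open>Both products of \<open>A\<close> with \<open>C ** P\<close> turn out to be the
    symmetric matrix \<open>P\<close>, from which all four Penrose conditions can be read
    off.\<close>
  have AG: "A ** (C ** P) = P"
    by (metis PB BC PP matrix_mul_assoc matrix_mul_rid)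
  have GA: "(C ** P) ** A = P"
    by (metis PA BP CB matrix_mul_assoc matrix_mul_lid)
  have "is_Moore_Penrose A (C ** P)"
    unfolding is_Moore_Penrose_def using AG GA PA P(1) PP by (metis matrix_mul_assoc)
  then show ?thesis ..
qed

lemma is_Moore_Penrose_inv_symmetric:
  fixes A :: "real ^ 'a ^ 'a"
  assumes "transpose A = A"
  shows "is_Moore_Penrose A (Moore_Penrose_inv A)"
  using is_Moore_Penrose_exists_symmetric[OF assms] Moore_Penrose_inv_eq by metis

section \<open>Least squares with a positive semidefinite weight matrix\<close>

lemma positive_semidefinite_null:
  fixes D :: "real ^ 'm ^ 'm"
  assumes sym: "transpose D = D" and psd: "\<And>v. 0 \<le> v \<bullet> (D *v v)" and null: "v \<bullet> (D *v v) = 0"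
  shows "D *v v = 0"
proof -
  define w where "w = D *v v"
  define s where "s = w \<bullet> w"
  define q where "q = w \<bullet> (D *v w)"
  \<comment> \<open>Along the line \<open>v + t *\<^sub>R w\<close> the form is
    \<open>2 * t * s + t\<^sup>2 * q\<close>, which is negative for small negative \<open>t\<close>
    unless \<open>s = 0\<close>. The denominator \<open>q + 1\<close> instead of \<open>q\<close>
    also covers \<open>q = 0\<close>.\<close>
  define t where "t = - s / (q + 1)"
  have q: "0 \<le> q"
    unfolding q_def by (rule psd)
  have "0 \<le> (v + t *\<^sub>R w) \<bullet> (D *v (v + t *\<^sub>R w))"
    by (rule psd)
  also have "\<dots> = 2 * t * s + t\<^sup>2 * q"
    using null inner_symmetric_matrix[OF sym, of v w]
    by (simp add: matrix_vector_right_distrib inner_add_left inner_add_right matrix_vector_mult_scaleR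
        s_def q_def w_def inner_commute power2_eq_square algebra_simps)
  also have "\<dots> = - (s / (q + 1))\<^sup>2 * (q + 2)"
    using q by (simp add: t_def divide_simps) (simp add: power2_eq_square algebra_simps)
  finally have "(s / (q + 1))\<^sup>2 * (q + 2) \<le> 0"
    by simp
  then have "(s / (q + 1))\<^sup>2 \<le> 0"
    using q by (simp add: mult_le_0_iff)
  then have "s = 0"
    using q by simp
  then show ?thesis
    by (simp add: s_def w_def)
qed

text \<open>With \<open>A\<close> = X'DX and \<open>c\<close> = X'Dy the claim is
  \<open>A *v (G *v c) = c\<close>. Since \<open>A ** G\<close> projects orthogonally onto the range
  of \<open>A\<close>, the defect \<open>z\<close> lies in the kernel of \<open>A\<close>. Then
  \<open>X *v z\<close> is a null vector of the form of \<open>D\<close>, so \<open>D\<close>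
  annihilates it. This makes \<open>z\<close> orthogonal to \<open>c\<close> as well as to the range
  of \<open>A\<close>, and therefore to itself.\<close>

lemma opt_coeff_normal_equations:
  fixes X :: "real ^ 'l ^ 'm" and D :: "real ^ 'm ^ 'm"
  assumes sym: "transpose D = D" and psd: "\<And>v. 0 \<le> v \<bullet> (D *v v)"
  shows "(D *v (y - X *v opt_coeff X D y)) v* X = 0"
proof -
  define A where "A = transpose X ** D ** X"
  define G where "G = Moore_Penrose_inv A"
  define c where "c = (D *v y) v* X"
  have A: "transpose A = A"
    by (simp add: A_def matrix_transpose_mul sym matrix_mul_assoc)
  have G: "A ** G ** A = A" "transpose (A ** G) = A ** G"
    using is_Moore_Penrose_inv_symmetric[OF A] by (auto simp: G_def is_Moore_Penrose_def)
  have X: "(X *v z) \<bullet> w = z \<bullet> (w v* X)" for z w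
    by (metis dot_lmul_matrix inner_commute)
  have A_vec: "A *v z = (D *v (X *v z)) v* X" for z
    by (simp add: A_def flip: matrix_vector_mul_assoc)
  have b: "opt_coeff X D y = G *v c"
    by (simp add: opt_coeff_def G_def A_def c_def flip: matrix_vector_mul_assoc)
  define z where "z = c - A *v (G *v c)"
  \<comment> \<open>This is the transpose of \<open>A ** G ** A = A\<close>, as \<open>A\<close> and
    \<open>A ** G\<close> are both symmetric.\<close>
  have "A ** (A ** G) = A"
    by (metis A G matrix_transpose_mul matrix_mul_assoc)
  then have Az: "A *v z = 0"
    by (simp add: z_def matrix_vector_mult_diff_distrib matrix_vector_mul_assoc)
  have "(X *v z) \<bullet> (D *v (X *v z)) = 0"
    by (simp add: X Az flip: A_vec)
  then have "D *v (X *v z) = 0"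
    using positive_semidefinite_null[OF sym psd] by blast
  then have "z \<bullet> c = 0"
    by (simp add: c_def inner_symmetric_matrix[OF sym] flip: X)
  moreover have "z \<bullet> (A *v (G *v c)) = 0"
    by (simp add: inner_symmetric_matrix[OF A] Az)
  ultimately have "z \<bullet> z = 0"
    unfolding z_def by (simp add: inner_diff_right)
  then have "c = A *v (G *v c)"
    by (simp add: z_def)
  then show ?thesis
    by (simp add: b A_vec c_def matrix_vector_mult_diff_distrib vector_matrix_mult_diff_distrib)
qed

text \<open>Pythagoras in the semi-inner product of \<open>D\<close>: by the normal equations the
  optimal residual \<open>e\<close> is \<open>D\<close>-orthogonal to the column space of
  \<open>X\<close>, and any other residual differs from \<open>e\<close> by some \<open>w\<close> in
  that space.\<close>

lemma opt_coeff_minimises: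
  fixes X :: "real ^ 'l ^ 'm" and D :: "real ^ 'm ^ 'm" and y :: "real ^ 'm"
  assumes sym: "transpose D = D" and psd: "\<And>v. 0 \<le> v \<bullet> (D *v v)"
  defines "r \<equiv> \<lambda>b. y - X *v b"
  shows "r (opt_coeff X D y) \<bullet> (D *v r (opt_coeff X D y)) \<le> r b \<bullet> (D *v r b)"
proof -
  define e where "e = r (opt_coeff X D y)"
  define w where "w = X *v (opt_coeff X D y - b)"
  have "w \<bullet> (D *v e) = 0"
    using opt_coeff_normal_equations[OF sym psd, where X = X and y = y]
    by (metis w_def e_def r_def dot_lmul_matrix inner_commute inner_zero_right)
  moreover from this have "e \<bullet> (D *v w) = 0"
    by (metis inner_symmetric_matrix[OF sym] inner_commute)
  moreover have "r b = e + w"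
    by (simp add: e_def w_def r_def matrix_vector_mult_diff_distrib)
  ultimately have "r b \<bullet> (D *v r b) = e \<bullet> (D *v e) + w \<bullet> (D *v w)"
    by (simp add: matrix_vector_right_distrib inner_add_left inner_add_right)
  then show ?thesis
    using psd[of w] by (simp add: e_def)
qed

section \<open>Variances as quadratic forms of the covariance matrix\<close>

lemma transpose_covariance_matrix: "transpose (covariance_matrix M Z) = covariance_matrix M Z"
  by (simp add: covariance_matrix_def transpose_def mult.commute)

lemma (in prob_space) variance_affine_covariance_matrix:
  fixes Z :: "'a \<Rightarrow> real ^ 'm"
  assumes meas: "\<And>i. (\<lambda>w. Z w $ i) \<in> borel_measurable M"
    and bounded: "\<And>i w. w \<in> space M \<Longrightarrow> \<bar>Z w $ i\<bar> \<le> C i"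
  shows "variance (\<lambda>w. Z w \<bullet> v + c) = v \<bullet> (covariance_matrix M Z *v v)"
proof -
  define m where "m i = expectation (\<lambda>w. Z w $ i)" for i
  have int: "integrable M (\<lambda>w. Z w $ i)" for i
    by (rule integrable_const_bound[where B = "C i"]) (use meas bounded in auto)
  \<comment> \<open>Integrability of the products lets the expectation pass through the double sum
    into which the square expands.\<close>
  have int2: "integrable M (\<lambda>w. (Z w $ i - m i) * (Z w $ j - m j))" for i j
  proof (rule integrable_const_bound[where B = "(C i + \<bar>m i\<bar>) * (C j + \<bar>m j\<bar>)"])
    have "\<bar>Z w $ k - m k\<bar> \<le> C k + \<bar>m k\<bar>" if "w \<in> space M" for w k
      using bounded[OF that, of k] by linarith
    then show "AE w in M. norm ((Z w $ i - m i) * (Z w $ j - m j)) \<le> (C i + \<bar>m i\<bar>) * (C j + \<bar>m j\<bar>)"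
      by (auto simp: abs_mult intro!: AE_I2 mult_mono) (metis abs_ge_zero order_trans)
  qed (use meas in measurable)
  have E: "expectation (\<lambda>w. Z w \<bullet> v + c) = (\<Sum>i\<in>UNIV. m i * v $ i) + c"
    using int by (simp add: inner_vec_def m_def prob_space)
  have "(Z w \<bullet> v + c - expectation (\<lambda>w. Z w \<bullet> v + c))\<^sup>2 =
      (\<Sum>i\<in>UNIV. \<Sum>j\<in>UNIV. v $ i * v $ j * ((Z w $ i - m i) * (Z w $ j - m j)))" for w
  proof -
    have "Z w \<bullet> v + c - expectation (\<lambda>w. Z w \<bullet> v + c) = (\<Sum>i\<in>UNIV. v $ i * (Z w $ i - m i))"
      unfolding E by (simp add: inner_vec_def sum_subtractf algebra_simps)
    then show ?thesis
      by (simp add: power2_eq_square sum_product mult_ac)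
  qed
  then have "variance (\<lambda>w. Z w \<bullet> v + c) =
      (\<Sum>i\<in>UNIV. \<Sum>j\<in>UNIV. v $ i * v $ j * expectation (\<lambda>w. (Z w $ i - m i) * (Z w $ j - m j)))"
    using int2 by simp
  also have "\<dots> = v \<bullet> (covariance_matrix M Z *v v)"
    by (simp add: inner_vec_def matrix_vector_mult_def covariance_matrix_def m_def sum_distrib_left mult_ac)
  finally show ?thesis .
qed

theorem theorem5p10:
  fixes M :: "'w measure"
    and R1 :: "'n::finite \<Rightarrow> 'w \<Rightarrow> real"
    and X :: "real ^ 'l::finite ^ ('n + 'n)"
    and d dt :: "real ^ ('n + 'n) ^ ('n + 'n)"
    and u ut :: "real ^ ('n + 'n) \<Rightarrow> real ^ ('n + 'n)"
  assumes "prob_space M"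
    and "\<And>i. R1 i \<in> borel_measurable M"
    and "\<And>i w. w \<in> space M \<Longrightarrow> R1 i w \<in> {0, 1}"
    and "\<And>i. 0 < integral\<^sup>L M (R1 i)" and "\<And>i. integral\<^sup>L M (R1 i) < 1"
    and d_def: "d = design_matrix M R1"
    and "corresponds_to_variance_bound d dt"
    and ut_def: "\<And>y. ut y = y - X *v opt_coeff X dt y"
    and u_def: "\<And>y. u y = y - X *v opt_coeff X d y"
  shows "(\<forall>y. scaled_qform d (u y) \<le> scaled_qform dt (ut y)) \<and>
    (transpose dt = dt \<longrightarrow> (\<forall>y. scaled_qform dt (ut y) \<le> scaled_qform dt (u y))) \<and>
    (let V = (\<lambda>y. prob_space.variance M (greg_estimator M R1 X y (opt_coeff X d y)));
         Bt = (\<lambda>y. scaled_qform dt (ut y));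
         B = (\<lambda>y. scaled_qform dt (u y))
     in is_bound_for Bt V \<and> is_bound_for B V \<and> (transpose dt = dt \<longrightarrow> tighter_than Bt B))"
proof -
  interpret prob_space M by fact
  define Z where "Z w = 1 v* (inv_pi M R1 ** treatment_matrix R1 w)" for w
  have Z: "Z w $ a = (\<Sum>i\<in>UNIV. \<Sum>k\<in>UNIV. inv_pi M R1 $ i $ k * treatment_matrix R1 w $ k $ a)" for w a
    by (simp add: Z_def vector_matrix_mult_def matrix_matrix_mult_def)
  have meas: "(\<lambda>w. Z w $ a) \<in> borel_measurable M" for a
  proof -
    have "(\<lambda>w. treatment_matrix R1 w $ k $ a) \<in> borel_measurable M" for k
      using assms(2) by (cases k; cases "k = a") (auto simp: treatment_matrix_def)
    then show ?thesis
      unfolding Z by measurable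
  qed
  \<comment> \<open>On \<open>space M\<close> the entries of the treatment matrix are 0 or 1, so the
    absolute entries of \<open>inv_pi M R1\<close> add up to a bound.\<close>
  have bounded: "\<bar>Z w $ a\<bar> \<le> (\<Sum>i\<in>UNIV. \<Sum>k\<in>UNIV. \<bar>inv_pi M R1 $ i $ k\<bar>)" if "w \<in> space M" for w a
  proof -
    have "\<bar>treatment_matrix R1 w $ k $ a\<bar> \<le> 1" for k
    proof (cases k)
      case (Inl i)
      then show ?thesis
        using assms(3)[OF that, of i] by (auto simp: treatment_matrix_def)
    next
      case (Inr i)
      then show ?thesis
        using assms(3)[OF that, of i] by (auto simp: treatment_matrix_def)
    qed
    then show ?thesis
      unfolding Z by (intro sum_norm_le[where 'a = real, unfolded real_norm_def])
        (simp add: abs_mult mult_left_le)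
  qed
  have d: "d = covariance_matrix M Z"
    by (simp add: d_def design_matrix_def Z_def[abs_def])
  have variance: "variance (\<lambda>w. Z w \<bullet> v + c) = v \<bullet> (d *v v)" for v c
    unfolding d by (rule variance_affine_covariance_matrix[OF meas bounded])
  have sym: "transpose d = d"
    unfolding d by (rule transpose_covariance_matrix)
  have psd: "0 \<le> v \<bullet> (d *v v)" for v
    using variance[of v 0] by (metis variance_positive)
  have bound: "scaled_qform d v \<le> scaled_qform dt v" for v
    using assms(7) by (simp add: corresponds_to_variance_bound_def)
  then have psd_dt: "0 \<le> v \<bullet> (dt *v v)" for v
    using psd[of v] by (auto simp: scaled_qform_def divide_le_cancel intro: order_trans)
  have first: "scaled_qform d (u y) \<le> scaled_qform dt (ut y)" for y
  proof -
    \<comment> \<open>The coefficient that is optimal for \<open>dt\<close> serves as a competitor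
      in the minimisation for \<open>d\<close>.\<close>
    have "scaled_qform d (u y) \<le> scaled_qform d (ut y)"
      unfolding scaled_qform_def u_def ut_def
      by (intro divide_right_mono opt_coeff_minimises[OF sym psd]) simp
    also have "\<dots> \<le> scaled_qform dt (ut y)"
      by (rule bound)
    finally show ?thesis .
  qed
  have second: "scaled_qform dt (ut y) \<le> scaled_qform dt (u y)" if "transpose dt = dt" for y
    unfolding scaled_qform_def u_def ut_def
    by (intro divide_right_mono opt_coeff_minimises[OF that psd_dt]) simp
  have V: "variance (greg_estimator M R1 X y b) = scaled_qform d (y - X *v b)" for y b
  proof -
    define n where "n = real CARD('n)"
    \<comment> \<open>The nonrandom part of the estimator, contributed by the identity matrix in the
      adjustment term. What is left is linear in \<open>Z w\<close> with coefficient vector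
      \<open>(1 / n) *\<^sub>R (y - X *v b)\<close>.\<close>
    define k where "k = ((1 :: real ^ ('n + 'n)) \<bullet> (X *v b)) / n"
    have "1 v* (A - mat 1) = 1 v* A - 1" for A :: "real ^ ('n + 'n) ^ ('n + 'n)"
      by (simp add: vector_matrix_mult_diff_rdistrib)
    then have "greg_estimator M R1 X y b w = Z w \<bullet> ((1 / n) *\<^sub>R (y - X *v b)) + k" for w
      by (simp add: greg_estimator_def Z_def k_def n_def inner_diff_left inner_diff_right diff_divide_distrib)
    then have "greg_estimator M R1 X y b = (\<lambda>w. Z w \<bullet> ((1 / n) *\<^sub>R (y - X *v b)) + k)"
      by (rule ext)
    then show ?thesis
      using variance[of "(1 / n) *\<^sub>R (y - X *v b)" k]
      by (simp add: scaled_qform_def n_def matrix_vector_mult_scaleR power2_eq_square)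
  qed
  show ?thesis
    using first second bound
    by (simp add: Let_def V is_bound_for_def tighter_than_def flip: u_def)
qed

end
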